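(* Let $d,B\ge1$ be integers, let $\mathcal{G}=\{G_r\}_{r=1}^{B}$ with $G_r\subset\{1,\dots,d\}$ and $\bigcup_{r=1}^{B}G_r=\{1,\dots,d\}$, let $p\in(1,+\infty]$ with conjugate exponent $q$, and let $\lambda>0$. Given $x\in\mathbb{R}^d$, it holds $$\pi_{\lambda K_p^{\mathcal{G}}}(x)=\pi_{\lambda K_p^{\hat{\mathcal{G}}}}(x),$$ where $\hat{\mathcal{G}}:=\{G\in\mathcal{G}:\ \|x\|_{G,q}>\lambda\}$.
   Context: Conjugate exponents: $1/p+1/q=1$ (so $q=1$ if $p=+\infty$). For $G\subset\{1,\dots,d\}$ and $x\in\mathbb{R}^d$, $\|x\|_{G,q}=(\sum_{j\in G}|x_j|^q)^{1/q}$ is the $\ell_q$ norm of the restriction of $x$ to the coordinates in $G$. For a subfamily $\mathcal{S}\subseteq\mathcal{G}$, $$K_p^{\mathcal{S}}=\{v\in\mathbb{R}^d:\ \|v\|_{G,q}\le 1\ \text{ for all } G\in\mathcal{S}\},$$ so that $K_p^{\emptyset}=\mathbb{R}^d$ and $\lambda K_p^{\mathcal{S}}=\{v:\|v\|_{G,q}\le\lambda\ \text{for all } G\in\mathcal{S}\}$ when $\lambda>0$ (with the convention $\lambda K_p^\emptyset=\mathbb{R}^d$). For a nonempty closed convex set $C\subset\mathbb{R}^d$, $\pi_C$ denotes the Euclidean projection onto $C$. *)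

theory Defs
  imports "HOL-Analysis.Analysis"
begin

(* The coordinate set {1..d} is the finite index type 'n of real^'n, with d = CARD('n). *)

definition group_norm :: "real \<Rightarrow> 'n set \<Rightarrow> real ^ 'n \<Rightarrow> real" where
  "group_norm q G x = (\<Sum>j\<in>G. \<bar>x $ j\<bar> powr q) powr (1 / q)"

(* The exponent is a finite real q because p > 1; p itself, possibly infinite, is an ereal,
   where 1 / \<infinity> = 0, so that q = 1 for p = \<infinity>. *)
definition conjugate_exponents :: "ereal \<Rightarrow> real \<Rightarrow> bool" where
  "conjugate_exponents p q \<longleftrightarrow> 1 / p + 1 / ereal q = 1"

(* The set usually written with subscript p is parametrised here by the conjugate exponent q. *)
definition K_set :: "real \<Rightarrow> 'n set set \<Rightarrow> (real ^ 'n) set" where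
  "K_set q S = {v. \<forall>G\<in>S. group_norm q G v \<le> 1}"

end

theory Submission
  imports Defs
begin

text \<open>
  The sets \<open>\<lambda> K\<close> are solid: membership depends on the coordinates only through
  monotone functions of their absolute values, so shrinking the absolute value of a coordinate
  never leaves the set.
  Hence a point \<open>y\<close> of a solid set that is nearest to \<open>x\<close> satisfies
  \<open>\<bar>y\<^sub>j\<bar> \<le> \<bar>x\<^sub>j\<bar>\<close> for all \<open>j\<close>: otherwise
  replacing \<open>y\<^sub>j\<close> by \<open>x\<^sub>j\<close> would give a strictly nearer point
  (\<open>nearest_point_solid_abs_le\<close>).

  Let \<open>C\<close> be the set cut out by all groups and \<open>D \<supseteq> C\<close> the one cut out
  by the groups whose norm at \<open>x\<close> exceeds \<open>\<lambda>\<close>.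
  If \<open>y\<close> is nearest to \<open>x\<close> in \<open>D\<close>, then each remaining group \<open>H\<close>
  satisfies \<open>\<parallel>y\<parallel>\<^sub>H \<le> \<parallel>x\<parallel>\<^sub>H \<le> \<lambda>\<close>, so
  \<open>y\<close> already lies in \<open>C\<close>. A minimiser over the larger set that lies in the smaller
  one is a minimiser there, and as \<open>D\<close> is closed and nonempty, such a minimiser exists; so the
  two sets have the same points nearest to \<open>x\<close> (\<open>closest_point_eq_if_minimisers_in_subset\<close>).
\<close>

definition solid_set :: "(real ^ 'n) set \<Rightarrow> bool" where
  "solid_set S \<longleftrightarrow> (\<forall>y\<in>S. \<forall>z. (\<forall>j. \<bar>z $ j\<bar> \<le> \<bar>y $ j\<bar>) \<longrightarrow> z \<in> S)"

lemma nearest_point_solid_abs_le: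
  fixes x y :: "real ^ ('n::finite)"
  assumes "solid_set S" and "y \<in> S" and nearest: "\<And>z. z \<in> S \<Longrightarrow> dist x y \<le> dist x z"
  shows "\<bar>y $ j\<bar> \<le> \<bar>x $ j\<bar>"
proof (rule ccontr)
  assume less: "\<not> \<bar>y $ j\<bar> \<le> \<bar>x $ j\<bar>"
  define z where "z = (\<chi> i. if i = j then x $ j else y $ i)"
  have "z \<in> S"
    using assms(1,2) less unfolding solid_set_def by (auto simp: z_def)
  have "(\<Sum>i\<in>UNIV. (dist (x $ i) (z $ i))\<^sup>2) < (\<Sum>i\<in>UNIV. (dist (x $ i) (y $ i))\<^sup>2)"
  proof (rule sum_strict_mono_ex1)
    show "\<exists>i\<in>UNIV. (dist (x $ i) (z $ i))\<^sup>2 < (dist (x $ i) (y $ i))\<^sup>2"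
      using less by (intro bexI[of _ j]) (auto simp: z_def)
  qed (auto simp: z_def)
  then have "dist x z < dist x y"
    by (simp add: dist_vec_def L2_set_def)
  with nearest[OF \<open>z \<in> S\<close>] show False by simp
qed

text \<open>
  Here \<^const>\<open>closest_point\<close> is a choice among the minimisers, so the two projections agree
  once the two sets have the same minimisers.
  Existence over \<open>D\<close> is what turns a minimiser over \<open>C\<close> into one over \<open>D\<close>:
  some minimiser over \<open>D\<close> lies in \<open>C\<close>, so both minimal distances are equal.
\<close>

lemma closest_point_eq_if_minimisers_in_subset:
  fixes x :: "'a::euclidean_space"
  assumes "C \<subseteq> D" and "closed D" and "D \<noteq> {}"
    and "\<And>y. y \<in> D \<Longrightarrow> (\<And>z. z \<in> D \<Longrightarrow> dist x y \<le> dist x z) \<Longrightarrow> y \<in> C"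
  shows "closest_point C x = closest_point D x"
proof -
  obtain m where m: "m \<in> D" "\<And>z. z \<in> D \<Longrightarrow> dist x m \<le> dist x z"
    using distance_attains_inf[OF assms(2,3)] by blast
  have "m \<in> C"
    using assms(4) m by blast
  have "(y \<in> C \<and> (\<forall>z\<in>C. dist x y \<le> dist x z)) \<longleftrightarrow>
        (y \<in> D \<and> (\<forall>z\<in>D. dist x y \<le> dist x z))" for y
  proof
    assume y: "y \<in> C \<and> (\<forall>z\<in>C. dist x y \<le> dist x z)"
    then have "dist x y \<le> dist x m"
      using \<open>m \<in> C\<close> by blast
    then have "\<forall>z\<in>D. dist x y \<le> dist x z"
      using m(2) by (blast intro: order_trans)
    then show "y \<in> D \<and> (\<forall>z\<in>D. dist x y \<le> dist x z)"
      using y assms(1) by blast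
  next
    assume "y \<in> D \<and> (\<forall>z\<in>D. dist x y \<le> dist x z)"
    then show "y \<in> C \<and> (\<forall>z\<in>C. dist x y \<le> dist x z)"
      using assms(1,4) by blast
  qed
  then show ?thesis
    unfolding closest_point_def by simp
qed

lemma group_norm_mono:
  assumes "q > 0" and "\<And>j. \<bar>z $ j\<bar> \<le> \<bar>y $ j\<bar>"
  shows "group_norm q H z \<le> group_norm q H y"
  unfolding group_norm_def using assms
  by (intro powr_mono2 sum_mono sum_nonneg) auto

lemma group_norm_scaleR:
  assumes "q > 0"
  shows "group_norm q H (c *\<^sub>R x) = \<bar>c\<bar> * group_norm q H x"
proof -
  have "(\<Sum>j\<in>H. \<bar>(c *\<^sub>R x) $ j\<bar> powr q) = \<bar>c\<bar> powr q * (\<Sum>j\<in>H. \<bar>x $ j\<bar> powr q)"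
    by (simp add: abs_mult powr_mult sum_distrib_left)
  then show ?thesis
    using assms by (simp add: group_norm_def powr_mult sum_nonneg powr_powr)
qed

lemma continuous_on_group_norm:
  assumes "q > 0"
  shows "continuous_on A (group_norm q H)"
  unfolding group_norm_def using assms
  by (intro continuous_on_powr' continuous_intros) (auto intro: sum_nonneg)

lemma scaled_K_set_eq:
  assumes "q > 0" and "lam > 0"
  shows "(*\<^sub>R) lam ` K_set q S = {v. \<forall>H\<in>S. group_norm q H v \<le> lam}"
proof (intro set_eqI iffI)
  fix v assume "v \<in> {v. \<forall>H\<in>S. group_norm q H v \<le> lam}"
  then have "inverse lam *\<^sub>R v \<in> K_set q S"
    using assms by (auto simp: K_set_def group_norm_scaleR field_simps)
  moreover have "v = lam *\<^sub>R (inverse lam *\<^sub>R v)"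
    using assms by simp
  ultimately show "v \<in> (*\<^sub>R) lam ` K_set q S" by blast
qed (use assms in \<open>auto simp: K_set_def group_norm_scaleR\<close>)

lemma solid_set_group_norm_le:
  assumes "q > 0"
  shows "solid_set {v. \<forall>H\<in>S. group_norm q H v \<le> lam}"
  unfolding solid_set_def using group_norm_mono[OF assms] by (smt (verit) mem_Collect_eq)

lemma closed_group_norm_le:
  fixes S :: "('n::finite) set set"
  assumes "q > 0"
  shows "closed {v. \<forall>H\<in>S. group_norm q H v \<le> lam}"
proof -
  have "closed {v. group_norm q H v \<le> lam}" for H :: "'n set"
    by (rule closed_Collect_le[OF continuous_on_group_norm[OF assms] continuous_on_const])
  then have "closed (\<Inter>H\<in>S. {v. group_norm q H v \<le> lam})"
    by blast
  moreover have "(\<Inter>H\<in>S. {v. group_norm q H v \<le> lam}) = {v. \<forall>H\<in>S. group_norm q H v \<le> lam}"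
    by blast
  ultimately show ?thesis by simp
qed

text \<open>
  Positivity of \<open>q\<close> is what makes the group norms monotone, homogeneous and continuous. The value
  \<open>q = 0\<close> has to be excluded first because \<open>1 / 0 = \<infinity>\<close> in the extended reals.
\<close>

lemma conjugate_exponent_pos:
  assumes "1 < p" and "conjugate_exponents p q"
  shows "q > 0"
proof -
  have sum1: "1 / p + 1 / ereal q = 1"
    using assms(2) by (simp add: conjugate_exponents_def)
  have "1 / ereal 0 = \<infinity>"
    by (simp add: divide_ereal_def)
  moreover have "1 / p + \<infinity> \<noteq> 1"
    by simp
  ultimately have "q \<noteq> 0"
    using sum1 by metis
  then have inv_q: "1 / ereal q = ereal (1 / q)"
    by (simp add: divide_ereal_def inverse_eq_divide)
  show ?thesis
  proof (cases p)
    case (real r)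
    then have "r > 1"
      using assms(1) by simp
    then have "1 / p = ereal (1 / r)"
      using real by (simp add: divide_ereal_def inverse_eq_divide)
    then have "1 / r + 1 / q = 1"
      using sum1 inv_q by simp
    moreover have "1 / r < 1"
      using \<open>r > 1\<close> by simp
    ultimately have "1 / q > 0" by linarith
    then show ?thesis by simp
  next
    case PInf
    then have "1 / q = 1"
      using sum1 inv_q by simp
    then show ?thesis by (simp add: divide_eq_1_iff)
  next
    case MInf
    then show ?thesis using assms(1) by simp
  qed
qed

theorem lemma2:
  fixes G :: "nat \<Rightarrow> ('n::finite) set" and B :: nat
    and p :: ereal and q lam :: real and x :: "real ^ 'n"
  assumes "B \<ge> 1"
    and "(\<Union>r\<in>{1..B}. G r) = UNIV"
    and "1 < p" and "conjugate_exponents p q"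
    and "lam > 0"
  shows "closest_point ((*\<^sub>R) lam ` K_set q (G ` {1..B})) x =
         closest_point ((*\<^sub>R) lam ` K_set q {H \<in> G ` {1..B}. group_norm q H x > lam}) x"
proof -
  have q: "q > 0"
    using conjugate_exponent_pos assms(3,4) by blast
  define active where "active = {H \<in> G ` {1..B}. group_norm q H x > lam}"
  define C where "C = {v. \<forall>H\<in>G ` {1..B}. group_norm q H v \<le> lam}"
  define D where "D = {v. \<forall>H\<in>active. group_norm q H v \<le> lam}"
  have "closest_point C x = closest_point D x"
  proof (rule closest_point_eq_if_minimisers_in_subset)
    show "C \<subseteq> D"
      by (auto simp: C_def D_def active_def)
    show "closed D"
      unfolding D_def by (rule closed_group_norm_le[OF q])
    have "0 \<in> D"
      using assms(5) q by (simp add: D_def group_norm_def)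
    then show "D \<noteq> {}" by blast
  next
    fix y assume y: "y \<in> D" "\<And>z. z \<in> D \<Longrightarrow> dist x y \<le> dist x z"
    have "solid_set D"
      unfolding D_def by (rule solid_set_group_norm_le[OF q])
    then have "\<bar>y $ j\<bar> \<le> \<bar>x $ j\<bar>" for j
      by (rule nearest_point_solid_abs_le[OF _ y])
    then have le: "group_norm q H y \<le> group_norm q H x" for H
      by (rule group_norm_mono[OF q])
    have "group_norm q H y \<le> lam" if "H \<in> G ` {1..B}" for H
    proof (cases "H \<in> active")
      case True
      then show ?thesis using y(1) unfolding D_def by blast
    next
      case False
      then have "group_norm q H x \<le> lam" using that unfolding active_def by simp
      then show ?thesis using le[of H] by linarith
    qed
    then show "y \<in> C"
      unfolding C_def by blast
  qed
  then show ?thesis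
    unfolding scaled_K_set_eq[OF q assms(5)] C_def D_def active_def .
qed

end
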